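(* Let $n\ge4$ and let $\varphi$ be a $\frac12$-derivation of the Lie algebra $\mathfrak{s}^{2}_{n,1}$. Then there are complex numbers $\alpha_1,\alpha_3,\dots,\alpha_n,\delta_n$ such that $$\varphi(e_1)=\alpha_1e_1+\sum_{i=3}^n\alpha_ie_i,\quad \varphi(e_i)=\alpha_1e_i\ (2\le i\le n),\quad \varphi(x)=\sum_{i=2}^{n-1}\alpha_{i+1}e_i+\delta_ne_n+\alpha_1x.$$
   Context: All algebras are over $\mathbb{C}$. A $\frac12$-derivation of a Lie algebra $(\mathfrak{L},[-,-])$ is a linear map $\varphi:\mathfrak{L}\to\mathfrak{L}$ with $\varphi([u,v])=\frac12([\varphi(u),v]+[u,\varphi(v)])$ for all $u,v\in\mathfrak{L}$. $\mathfrak{s}^{2}_{n,1}$ is the $(n+1)$-dimensional Lie algebra with basis $e_1,\dots,e_n,x$ and brackets $[e_i,e_1]=e_{i+1}$ for $2\le i\le n-1$; $[e_i,x]=e_i$ for $2\le i\le n$; brackets of basis elements not determined by these and antisymmetry are zero. *)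

theory Defs
  imports Complex_Main "HOL-Library.Function_Algebras"
begin

text \<open>Carriers are subspaces \<open>L\<close> of an ambient complex vector space, so that the dimension may
  depend on a natural number. Maps and brackets are only constrained on \<open>L\<close>.\<close>

locale complex_lie_algebra = vector_space scale
  for scale :: "complex \<Rightarrow> 'a::ab_group_add \<Rightarrow> 'a"  (infixr \<open>*s\<close> 75) +
  fixes L :: "'a set" and br :: "'a \<Rightarrow> 'a \<Rightarrow> 'a"
  assumes subspace_L: "subspace L"
    and br_closed: "u \<in> L \<Longrightarrow> v \<in> L \<Longrightarrow> br u v \<in> L"
    and br_add_left: "u \<in> L \<Longrightarrow> v \<in> L \<Longrightarrow> w \<in> L \<Longrightarrow> br (u + v) w = br u w + br v w"
    and br_add_right: "u \<in> L \<Longrightarrow> v \<in> L \<Longrightarrow> w \<in> L \<Longrightarrow> br u (v + w) = br u v + br u w"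
    and br_scale_left: "u \<in> L \<Longrightarrow> v \<in> L \<Longrightarrow> br (c *s u) v = c *s br u v"
    and br_scale_right: "u \<in> L \<Longrightarrow> v \<in> L \<Longrightarrow> br u (c *s v) = c *s br u v"
    and br_self: "u \<in> L \<Longrightarrow> br u u = 0"
    and jacobi: "u \<in> L \<Longrightarrow> v \<in> L \<Longrightarrow> w \<in> L \<Longrightarrow>
      br u (br v w) + br v (br w u) + br w (br u v) = 0"
begin

definition linear_endo :: "('a \<Rightarrow> 'a) \<Rightarrow> bool" where
  "linear_endo \<phi> \<longleftrightarrow>
     (\<forall>u\<in>L. \<phi> u \<in> L) \<and>
     (\<forall>u\<in>L. \<forall>v\<in>L. \<phi> (u + v) = \<phi> u + \<phi> v) \<and>
     (\<forall>c. \<forall>u\<in>L. \<phi> (c *s u) = c *s \<phi> u)"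

definition half_derivation :: "('a \<Rightarrow> 'a) \<Rightarrow> bool" where
  "half_derivation \<phi> \<longleftrightarrow>
     linear_endo \<phi> \<and>
     (\<forall>u\<in>L. \<forall>v\<in>L. \<phi> (br u v) = (1/2) *s (br (\<phi> u) v + br u (\<phi> v)))"

end

text \<open>The last three axioms are the brackets of basis elements that are neither listed nor forced by
  antisymmetry, hence zero.\<close>

locale lie_algebra_s2n1 = complex_lie_algebra scale L br
  for scale :: "complex \<Rightarrow> 'a::ab_group_add \<Rightarrow> 'a"  (infixr \<open>*s\<close> 75)
    and L :: "'a set" and br :: "'a \<Rightarrow> 'a \<Rightarrow> 'a" +
  fixes n :: nat and e :: "nat \<Rightarrow> 'a" and x :: 'a
  assumes basis_inj: "inj_on e {1..n}"
    and basis_x: "x \<notin> e ` {1..n}"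
    and basis_independent: "independent (insert x (e ` {1..n}))"
    and basis_span: "span (insert x (e ` {1..n})) = L"
    and br_e_e1: "2 \<le> i \<Longrightarrow> i \<le> n - 1 \<Longrightarrow> br (e i) (e 1) = e (i + 1)"
    and br_e_x: "2 \<le> i \<Longrightarrow> i \<le> n \<Longrightarrow> br (e i) x = e i"
    and br_en_e1: "br (e n) (e 1) = 0"
    and br_e1_x: "br (e 1) x = 0"
    and br_e_e: "2 \<le> i \<Longrightarrow> i \<le> n \<Longrightarrow> 2 \<le> j \<Longrightarrow> j \<le> n \<Longrightarrow> br (e i) (e j) = 0"

text \<open>The axioms are consistent for every \<open>n\<close>: a model on coordinate vectors, with coordinate 0
  belonging to \<open>x\<close> and coordinate \<open>i\<close> to \<open>e i\<close>.\<close>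

definition s2n1_br :: "nat \<Rightarrow> (nat \<Rightarrow> complex) \<Rightarrow> (nat \<Rightarrow> complex) \<Rightarrow> nat \<Rightarrow> complex" where
  "s2n1_br n u v = (\<lambda>k.
     (if 2 \<le> k \<and> k \<le> n then u k * v 0 - u 0 * v k else 0) +
     (if 3 \<le> k \<and> k \<le> n then u (k - 1) * v 1 - u 1 * v (k - 1) else 0))"

lemma lie_algebra_s2n1_model:
  fixes n :: nat
  assumes n: "2 \<le> n"
  defines "b \<equiv> \<lambda>k i. of_bool (i = k) :: complex"
  shows "lie_algebra_s2n1 (\<lambda>c u i. c * u i) {u. \<forall>i>n. u i = 0} (s2n1_br n) n b (b 0)"
proof -
  interpret vector_space "\<lambda>c u i. c * u i :: complex"
    by unfold_locales (auto simp: fun_eq_iff algebra_simps)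
  have sub: "subspace {u::nat\<Rightarrow>complex. \<forall>i>n. u i = 0}"
    by (auto simp: subspace_def)
  have inj: "inj b"
    by (auto simp: inj_on_def b_def fun_eq_iff of_bool_eq_iff)
  have "{..n} = insert 0 {1..n}" by auto
  then have B: "insert (b 0) (b ` {1..n}) = b ` {..n}"
    by simp
  have sum_b: "(\<Sum>v\<in>b ` {..n}. (\<lambda>i. c v * v i)) = (\<lambda>i. if i \<le> n then c (b i) else 0)" for c
  proof -
    have "(\<Sum>v\<in>b ` {..n}. (\<lambda>i. c v * v i)) = (\<Sum>k\<le>n. (\<lambda>i. c (b k) * b k i))"
      by (subst sum.reindex) (use inj in \<open>auto simp: inj_on_def o_def\<close>)
    also have "\<dots> = (\<lambda>i. \<Sum>k\<le>n. c (b k) * b k i)"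
      by (induction n) auto
    also have "\<dots> = (\<lambda>i. if i \<le> n then c (b i) else 0)"
      by (simp add: b_def fun_eq_iff)
    finally show ?thesis .
  qed
  have ind: "independent (b ` {..n})"
  proof (rule independent_if_scalars_zero)
    fix f v assume *: "(\<Sum>v\<in>b ` {..n}. (\<lambda>i. f v * v i)) = 0" and "v \<in> b ` {..n}"
    then obtain k where "k \<le> n" "v = b k" by blast
    with fun_cong[OF *[unfolded sum_b], of k] show "f v = 0" by simp
  qed simp
  have sp: "span (b ` {..n}) = {u. \<forall>i>n. u i = 0}"
  proof (intro equalityI subsetI)
    fix u assume "u \<in> span (b ` {..n})"
    then show "u \<in> {u. \<forall>i>n. u i = 0}"
      by (auto simp: span_finite sum_b)
  next
    fix u :: "nat \<Rightarrow> complex" assume u: "u \<in> {u. \<forall>i>n. u i = 0}"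
    have "u = (\<Sum>v\<in>b ` {..n}. (\<lambda>i. u (inv b v) * v i))"
      unfolding sum_b using u by (auto simp: fun_eq_iff inv_f_f[OF inj])
    then show "u \<in> span (b ` {..n})"
      by (auto simp: span_finite)
  qed
  have br_b: "s2n1_br n (b i) (b j) = (\<lambda>k.
      (if 2 \<le> k \<and> k \<le> n then of_bool (k = i \<and> j = 0) - of_bool (i = 0 \<and> k = j) else 0) +
      (if 3 \<le> k \<and> k \<le> n then of_bool (k = i + 1 \<and> j = 1) - of_bool (i = 1 \<and> k = j + 1) else 0))" for i j
    by (rule ext) (auto simp: s2n1_br_def b_def)
  show ?thesis
  proof
    show "subspace {u::nat\<Rightarrow>complex. \<forall>i>n. u i = 0}" by (fact sub)
    show "inj_on b {1..n}" using inj by (rule inj_on_subset) simp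
    show "b 0 \<notin> b ` {1..n}" using inj by (auto dest: injD)
    show "independent (insert (b 0) (b ` {1..n}))" using ind B by simp
    show "span (insert (b 0) (b ` {1..n})) = {u. \<forall>i>n. u i = 0}" using sp B by simp
    show "s2n1_br n u (s2n1_br n v w) + s2n1_br n v (s2n1_br n w u) + s2n1_br n w (s2n1_br n u v) = 0" for u v w
    proof
      fix k
      consider "k \<le> 1 \<or> k > n" | "k = 2" "k \<le> n" | "k = 3" "k \<le> n" | "4 \<le> k" "k \<le> n"
        by linarith
      then show "(s2n1_br n u (s2n1_br n v w) + s2n1_br n v (s2n1_br n w u) +
          s2n1_br n w (s2n1_br n u v)) k = 0 k"
        by cases (auto simp: s2n1_br_def algebra_simps)
    qed
    show "s2n1_br n (b i) (b 1) = b (i + 1)" if "2 \<le> i" "i \<le> n - 1" for i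
      unfolding br_b using that by (auto simp: b_def fun_eq_iff)
    show "s2n1_br n (b i) (b 0) = b i" if "2 \<le> i" "i \<le> n" for i
      unfolding br_b using that by (auto simp: b_def fun_eq_iff)
    show "s2n1_br n (b n) (b 1) = 0"
      unfolding br_b using n by (auto simp: fun_eq_iff)
    show "s2n1_br n (b 1) (b 0) = 0"
      unfolding br_b by (auto simp: fun_eq_iff)
    show "s2n1_br n (b i) (b j) = 0" if "2 \<le> i" "i \<le> n" "2 \<le> j" "j \<le> n" for i j
      unfolding br_b using that by (auto simp: fun_eq_iff)
  qed (auto simp: s2n1_br_def fun_eq_iff algebra_simps)
qed

end

theory Submission
  imports Defs
begin

text \<open>The condition on \<open>[e\<^sub>i, x] = e\<^sub>i\<close> for \<open>i \<ge> 2\<close> reads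
  \<open>2 \<phi>(e\<^sub>i) = [\<phi>(e\<^sub>i), x] + [e\<^sub>i, \<phi>(x)]\<close>. As bracketing with \<open>x\<close> projects onto the span of
  \<open>e\<^sub>2, \<dots>, e\<^sub>n\<close>, it forces \<open>\<phi>(e\<^sub>i) = d e\<^sub>i + s e\<^sub>i\<^sub>+\<^sub>1\<close>, where \<open>d\<close> and \<open>s\<close> are the coefficients of
  \<open>x\<close> and \<open>e\<^sub>1\<close> in \<open>\<phi>(x)\<close>. The condition on \<open>[e\<^sub>2, e\<^sub>1] = e\<^sub>3\<close> then gives \<open>s = 0\<close> (here \<open>n \<ge> 4\<close>
  enters) and shows that \<open>\<phi>(e\<^sub>1)\<close> has \<open>e\<^sub>1\<close>-coefficient \<open>d\<close> and no \<open>x\<close>-component. Finally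
  \<open>[e\<^sub>1, x] = 0\<close> matches the remaining coefficients of \<open>\<phi>(e\<^sub>1)\<close> and \<open>\<phi>(x)\<close>.\<close>

context complex_lie_algebra
begin

lemma br_swap:
  assumes "u \<in> L" "v \<in> L"
  shows "br u v = - br v u"
proof -
  have "u + v \<in> L" using assms subspace_L by (simp add: subspace_add)
  then have "0 = br (u + v) (u + v)" by (simp add: br_self)
  also have "\<dots> = br u v + br v u"
    using assms \<open>u + v \<in> L\<close> by (simp add: br_add_left br_add_right br_self[of u] br_self[of v])
  finally show ?thesis by (simp add: eq_neg_iff_add_eq_0)
qed

lemma br_zero_right: "u \<in> L \<Longrightarrow> br u 0 = 0"
  using br_scale_right[of u u 0] by simp

lemma br_sum_scale_right:
  assumes "u \<in> L" "\<And>i. i \<in> I \<Longrightarrow> v i \<in> L"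
  shows "br u (\<Sum>i\<in>I. c i *s v i) = (\<Sum>i\<in>I. c i *s br u (v i))"
  using assms(2)
proof (induction I rule: infinite_finite_induct)
  case (insert i I)
  have "c i *s v i \<in> L" "(\<Sum>i\<in>I. c i *s v i) \<in> L"
    using insert subspace_L by (auto intro: subspace_sum subspace_scale)
  with insert show ?case
    using assms(1) by (simp add: br_add_right br_scale_right)
qed (auto simp: br_zero_right assms(1))

end

context lie_algebra_s2n1
begin

text \<open>Coefficient functions are total on the naturals, so shifts such as \<open>i + 1\<close>
  may leave the range: there a coefficient contributes nothing, and \<open>e (n + 1)\<close> is in
  effect read as 0.\<close>

definition comb :: "(nat \<Rightarrow> complex) \<Rightarrow> complex \<Rightarrow> 'a" where
  "comb f g = (\<Sum>j=1..n. f j *s e j) + g *s x"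

lemma e_in_L: "1 \<le> i \<Longrightarrow> i \<le> n \<Longrightarrow> e i \<in> L"
  using basis_span span_base[of "e i" "insert x (e ` {1..n})"] by auto

lemma x_in_L: "x \<in> L"
  using basis_span span_base[of x "insert x (e ` {1..n})"] by auto

lemma comb_in_L: "comb f g \<in> L"
  unfolding comb_def using subspace_L
  by (auto intro!: subspace_add subspace_sum subspace_scale e_in_L x_in_L)

lemma comb_add: "comb f g + comb f' g' = comb (\<lambda>j. f j + f' j) (g + g')"
  by (simp add: comb_def scale_left_distrib sum.distrib algebra_simps)

lemma comb_scale: "c *s comb f g = comb (\<lambda>j. c * f j) (c * g)"
  by (simp add: comb_def scale_right_distrib scale_sum_right)

lemma comb_uminus: "- comb f g = comb (\<lambda>j. - f j) (- g)"
  using comb_scale[of "-1" f g] by simp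

lemma sum_basis:
  "(\<Sum>v\<in>insert x (e ` {1..n}). u v *s v) = comb (\<lambda>j. u (e j)) (u x)"
  using basis_x by (simp add: comb_def sum.reindex[OF basis_inj] add.commute del: One_nat_def)

lemma comb_exhaust:
  assumes "u \<in> L"
  obtains f g where "u = comb f g"
proof -
  have "u \<in> span (insert x (e ` {1..n}))" using assms basis_span by simp
  then obtain h where "u = (\<Sum>v\<in>insert x (e ` {1..n}). h v *s v)"
    by (subst (asm) span_finite) auto
  then show thesis using that sum_basis by metis
qed

lemma comb_eq_0D:
  assumes "comb f g = 0"
  shows "g = 0" and "1 \<le> j \<Longrightarrow> j \<le> n \<Longrightarrow> f j = 0"
proof -
  \<comment> \<open>Independence concerns coefficients attached to vectors, so \<open>f\<close> and
    \<open>g\<close> are carried over to the basis vectors; \<open>basis_inj\<close> and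
    \<open>basis_x\<close> make this unambiguous.\<close>
  define h where "h v = (if v = x then g else f (inv_into {1..n} e v))" for v
  have h: "h x = g" "\<And>j. j \<in> {1..n} \<Longrightarrow> h (e j) = f j"
    using basis_inj basis_x by (auto simp: h_def)
  have "comb (\<lambda>j. h (e j)) (h x) = comb f g"
    unfolding comb_def using h by simp
  then have "(\<Sum>v\<in>insert x (e ` {1..n}). h v *s v) = 0"
    using assms by (simp only: sum_basis)
  then have *: "h v = 0" if "v \<in> insert x (e ` {1..n})" for v
    using independentD[OF basis_independent _ subset_refl] that by blast
  show "g = 0" using *[of x] h(1) by simp
  show "1 \<le> j \<Longrightarrow> j \<le> n \<Longrightarrow> f j = 0" using *[of "e j"] h(2)[of j] by simp
qed

lemma comb_eqD:
  assumes "comb f g = comb f' g'"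
  shows "g = g'" and "1 \<le> j \<Longrightarrow> j \<le> n \<Longrightarrow> f j = f' j"
proof -
  have "comb f g + - comb f' g' = 0" using assms by simp
  then have *: "comb (\<lambda>j. f j + - f' j) (g + - g') = 0"
    by (simp only: comb_uminus comb_add)
  show "g = g'" using comb_eq_0D(1)[OF *] by simp
  show "1 \<le> j \<Longrightarrow> j \<le> n \<Longrightarrow> f j = f' j" using comb_eq_0D(2)[OF *] by simp
qed

lemma comb_cong: "(\<And>j. 1 \<le> j \<Longrightarrow> j \<le> n \<Longrightarrow> f j = f' j) \<Longrightarrow> comb f g = comb f' g"
  by (simp add: comb_def)

lemma comb_delta: "comb (\<lambda>j. c * of_bool (j = i)) 0 = (if 1 \<le> i \<and> i \<le> n then c *s e i else 0)"
proof -
  have "(\<Sum>j=1..n. (c * of_bool (j = i)) *s e j) = (\<Sum>j=1..n. if j = i then c *s e j else 0)"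
    by (rule sum.cong) auto
  then show ?thesis by (simp add: comb_def)
qed

lemma br_comb_right:
  assumes "u \<in> L"
  shows "br u (comb f g) = (\<Sum>j=1..n. f j *s br u (e j)) + g *s br u x"
proof -
  have "(\<Sum>j=1..n. f j *s e j) \<in> L" "g *s x \<in> L"
    using subspace_L by (auto intro!: subspace_sum subspace_scale e_in_L x_in_L)
  then show ?thesis
    using assms br_sum_scale_right[of u "{1..n}" e f]
    by (simp add: comb_def br_add_right br_scale_right e_in_L x_in_L)
qed

text \<open>Expanding \<open>[x, comb f g]\<close> in its second argument gives \<open>-e j\<close>
  for each \<open>j \<ge> 2\<close>; antisymmetry cancels this sign.\<close>

lemma br_comb_x: "br (comb f g) x = comb (\<lambda>j. if 2 \<le> j then f j else 0) 0"
proof -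
  have "br x (e j) = (if 2 \<le> j then - e j else 0)" if "1 \<le> j" "j \<le> n" for j
    using that br_swap[OF x_in_L e_in_L[of j]] br_e_x[of j] br_e1_x
    by (cases "j = 1") auto
  then have "(\<Sum>j=1..n. f j *s br x (e j)) = - (\<Sum>j=1..n. (if 2 \<le> j then f j else 0) *s e j)"
    unfolding sum_negf[symmetric] by (intro sum.cong) auto
  then show ?thesis
    by (simp add: br_swap[OF comb_in_L x_in_L] br_comb_right x_in_L br_self)
      (simp add: comb_def)
qed

text \<open>Since \<open>e 2, ..., e n\<close> commute, only the \<open>e 1\<close> and
  \<open>x\<close> coordinates survive. For \<open>i = n\<close> the index \<open>i + 1\<close> is
  out of range, in accordance with \<open>[e n, e 1] = 0\<close>.\<close>

lemma br_e_comb: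
  assumes i: "2 \<le> i" "i \<le> n"
  shows "br (e i) (comb f g) = comb (\<lambda>j. f 1 * of_bool (j = i + 1) + g * of_bool (j = i)) 0"
proof -
  have "(\<Sum>j=1..n. f j *s br (e i) (e j)) = (\<Sum>j=1..n. if j = 1 then f 1 *s br (e i) (e 1) else 0)"
    using i by (intro sum.cong) (auto simp: br_e_e)
  also have "\<dots> = f 1 *s br (e i) (e 1)" using i by simp
  also have "\<dots> = comb (\<lambda>j. f 1 * of_bool (j = i + 1)) 0"
    using i br_e_e1[of i] br_en_e1 unfolding comb_delta by (cases "i = n") auto
  finally have "br (e i) (comb f g) =
      comb (\<lambda>j. f 1 * of_bool (j = i + 1)) 0 + comb (\<lambda>j. g * of_bool (j = i)) 0"
    using i by (simp add: br_comb_right e_in_L br_e_x comb_delta[of g i])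
  then show ?thesis by (simp add: comb_add)
qed

text \<open>Up to sign this is the shift \<open>e j\<close> to \<open>e (j + 1)\<close> on
  \<open>e 2, ..., e n\<close>; it kills \<open>e 1\<close>, \<open>e n\<close> and
  \<open>x\<close>.\<close>

lemma br_e1_comb:
  assumes n: "2 \<le> n"
  shows "br (e 1) (comb f g) = comb (\<lambda>j. if 3 \<le> j then - f (j - 1) else 0) 0"
proof -
  have e1: "e 1 \<in> L" using n by (simp add: e_in_L)
  have br1: "br (e 1) (e j) = (if 2 \<le> j \<and> j < n then - e (j + 1) else 0)" if "1 \<le> j" "j \<le> n" for j
    using that br_swap[OF e1 e_in_L[of j]] br_e_e1[of j] br_en_e1 br_self[OF e1]
    by (cases "j = 1"; cases "j = n") auto
  have "br (e 1) (comb f g) = (\<Sum>j=1..n. if 2 \<le> j \<and> j < n then - f j *s e (j + 1) else 0)"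
    unfolding br_comb_right[OF e1] br_e1_x scale_zero_right add_0_right
    by (intro sum.cong) (auto simp: br1 simp del: One_nat_def)
  also have "\<dots> = (\<Sum>j\<in>{2..<n}. - f j *s e (j + 1))"
    by (rule sum.mono_neutral_cong_right) auto
  also have "\<dots> = (\<Sum>j\<in>{3..<Suc n}. - f (j - 1) *s e j)"
    using sum.shift_bounds_Suc_ivl[of "\<lambda>j. - f (j - 1) *s e j" 2 n] by (simp add: numeral_3_eq_3)
  also have "\<dots> = (\<Sum>j=1..n. (if 3 \<le> j then - f (j - 1) else 0) *s e j)"
    by (rule sum.mono_neutral_cong_left) auto
  finally show ?thesis by (simp add: comb_def)
qed

lemma half_derivation_form:
  assumes n: "4 \<le> n" and hd: "half_derivation \<phi>"
  shows "\<exists>(\<alpha> :: nat \<Rightarrow> complex) (\<delta> :: complex).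
    \<phi> (e 1) = \<alpha> 1 *s e 1 + (\<Sum>i=3..n. \<alpha> i *s e i) \<and>
    (\<forall>i\<in>{2..n}. \<phi> (e i) = \<alpha> 1 *s e i) \<and>
    \<phi> x = (\<Sum>i=2..n-1. \<alpha> (i + 1) *s e i) + \<delta> *s e n + \<alpha> 1 *s x"
proof -
  have closed: "\<phi> u \<in> L" if "u \<in> L" for u
    using hd that by (simp add: half_derivation_def linear_endo_def)
  have "\<phi> (0 *s x) = 0 *s \<phi> x"
    using hd x_in_L unfolding half_derivation_def linear_endo_def by blast
  then have phi_0: "\<phi> 0 = 0" by simp
  have double: "2 *s \<phi> (br u v) = br (\<phi> u) v + br u (\<phi> v)" if "u \<in> L" "v \<in> L" for u v
    using hd that by (simp add: half_derivation_def)
  have e1: "e 1 \<in> L" using n by (simp add: e_in_L)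
  obtain p q where phi_e1: "\<phi> (e 1) = comb p q"
    using comb_exhaust closed e1 by metis
  obtain s d where phi_x: "\<phi> x = comb s d"
    using comb_exhaust closed x_in_L by metis
  have phi_e: "\<phi> (e i) = comb (\<lambda>j. s 1 * of_bool (j = i + 1) + d * of_bool (j = i)) 0"
    if i: "2 \<le> i" "i \<le> n" for i
  proof -
    have ei: "e i \<in> L" using i by (simp add: e_in_L)
    obtain f g where fg: "\<phi> (e i) = comb f g"
      using comb_exhaust closed ei by metis
    have "2 *s comb f g = br (comb f g) x + br (e i) (comb s d)"
      using double[OF ei x_in_L] i by (simp add: br_e_x fg phi_x)
    then have *: "comb (\<lambda>j. 2 * f j) (2 * g) =
        comb (\<lambda>j. (if 2 \<le> j then f j else 0) + (s 1 * of_bool (j = i + 1) + d * of_bool (j = i))) (0 + 0)"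
      unfolding comb_scale br_comb_x br_e_comb[OF i] comb_add .
    have "g = 0" using comb_eqD(1)[OF *] by simp
    \<comment> \<open>For \<open>j \<ge> 2\<close>, one copy of \<open>f j\<close> cancels against
      \<open>2 * f j\<close>; for \<open>j = 1\<close> the right-hand side vanishes because
      \<open>i \<ge> 2\<close>.\<close>
    moreover have "f j = s 1 * of_bool (j = i + 1) + d * of_bool (j = i)" if "1 \<le> j" "j \<le> n" for j
      using comb_eqD(2)[OF * that] i that by (cases "2 \<le> j") auto
    ultimately show ?thesis unfolding fg by (auto intro: comb_cong)
  qed
  have e2: "e 2 \<in> L" using n by (simp add: e_in_L)
  have "2 *s \<phi> (e 3) = br (\<phi> (e 2)) (e 1) + br (e 2) (\<phi> (e 1))"
    using double[OF e2 e1] br_e_e1[of 2] n by simp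
  also have "br (\<phi> (e 2)) (e 1) = - br (e 1) (\<phi> (e 2))"
    using br_swap closed e1 e2 by blast
  finally have *: "comb (\<lambda>j. 2 * (s 1 * of_bool (j = 3 + 1) + d * of_bool (j = 3))) (2 * 0) =
      comb (\<lambda>j. - (if 3 \<le> j then - (s 1 * of_bool (j - 1 = 2 + 1) + d * of_bool (j - 1 = 2)) else 0)
        + (p 1 * of_bool (j = 2 + 1) + q * of_bool (j = 2))) (- 0 + 0)"
    using n by (simp only: phi_e phi_e1 br_e1_comb br_e_comb comb_scale comb_uminus comb_add)
  \<comment> \<open>Coordinates 2, 3 and 4 read \<open>0 = q\<close>, \<open>2 * d = d + p 1\<close>
    and \<open>2 * s 1 = s 1\<close>; the last is available because
    \<open>n \<ge> 4\<close>.\<close>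
  have q: "q = 0" using comb_eqD(2)[OF *, of 2] n by simp
  have p1: "p 1 = d" using comb_eqD(2)[OF *, of 3] n by simp
  have s1: "s 1 = 0" using comb_eqD(2)[OF *, of 4] n by simp
  have "br (comb p q) x + br (e 1) (comb s d) = comb (\<lambda>_. 0) 0"
    using double[OF e1 x_in_L] unfolding br_e1_x phi_0 phi_e1 phi_x by (simp add: comb_def)
  then have **: "comb (\<lambda>j. (if 2 \<le> j then p j else 0) + (if 3 \<le> j then - s (j - 1) else 0)) (0 + 0)
      = comb (\<lambda>_. 0) 0"
    using n by (simp only: br_comb_x br_e1_comb comb_add)
  \<comment> \<open>The shift starts at coordinate 3, so \<open>p 2\<close> stands alone at
    coordinate 2, while coordinate \<open>i + 1\<close> pairs \<open>p (i + 1)\<close> with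
    \<open>s i\<close>.\<close>
  have p2: "p 2 = 0" using comb_eqD(2)[OF **, of 2] n by simp
  have sp: "s i = p (i + 1)" if "2 \<le> i" "i \<le> n - 1" for i
    using comb_eqD(2)[OF **, of "i + 1"] that n by simp
  have split_low: "(\<Sum>j=1..n. f j *s e j) = f 1 *s e 1 + (\<Sum>j=2..n. f j *s e j)" for f
    using n by (simp add: sum.atLeast_Suc_atMost numeral_2_eq_2)
  have "(\<Sum>j=2..n. p j *s e j) = (\<Sum>j=3..n. p j *s e j)"
    using n p2 by (simp add: sum.atLeast_Suc_atMost[of 2] numeral_3_eq_3)
  then have "\<phi> (e 1) = p 1 *s e 1 + (\<Sum>i=3..n. p i *s e i)"
    unfolding phi_e1 comb_def q split_low by simp
  moreover have "\<phi> (e i) = p 1 *s e i" if "i \<in> {2..n}" for i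
    using that comb_delta[of d i] by (simp add: phi_e s1 p1 del: One_nat_def)
  \<comment> \<open>The shift annihilates \<open>e n\<close>, so \<open>s n\<close> stays free and
    becomes the witness for \<delta>; \<open>p\<close> is the witness for \<alpha>.\<close>
  moreover have "\<phi> x = (\<Sum>i=2..n-1. p (i + 1) *s e i) + s n *s e n + p 1 *s x"
  proof -
    have "{2..n} = insert n {2..n-1}" using n by auto
    then have "(\<Sum>j=2..n. s j *s e j) = s n *s e n + (\<Sum>j=2..n-1. s j *s e j)"
      using n by simp
    also have "(\<Sum>j=2..n-1. s j *s e j) = (\<Sum>j=2..n-1. p (j + 1) *s e j)"
      by (intro sum.cong) (auto simp: sp)
    finally show ?thesis by (simp add: phi_x comb_def split_low s1 p1 add.commute del: One_nat_def)
  qed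
  ultimately show ?thesis by blast
qed

end

theorem theorem2p2:
  fixes n :: nat
    and scale :: "complex \<Rightarrow> 'a::ab_group_add \<Rightarrow> 'a" (infixr \<open>*s\<close> 75)
    and L :: "'a set" and br :: "'a \<Rightarrow> 'a \<Rightarrow> 'a"
    and e :: "nat \<Rightarrow> 'a" and x :: 'a
    and \<phi> :: "'a \<Rightarrow> 'a"
  assumes "4 \<le> n"
    and "lie_algebra_s2n1 scale L br n e x"
    and "complex_lie_algebra.half_derivation scale L br \<phi>"
  shows "\<exists>(\<alpha> :: nat \<Rightarrow> complex) (\<delta> :: complex).
    \<phi> (e 1) = \<alpha> 1 *s e 1 + (\<Sum>i=3..n. \<alpha> i *s e i) \<and>
    (\<forall>i\<in>{2..n}. \<phi> (e i) = \<alpha> 1 *s e i) \<and>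
    \<phi> x = (\<Sum>i=2..n-1. \<alpha> (i + 1) *s e i) + \<delta> *s e n + \<alpha> 1 *s x"
proof -
  interpret lie_algebra_s2n1 scale L br n e x by fact
  show ?thesis using assms(1,3) by (rule half_derivation_form)
qed

end
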